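(* Let $\mathscr T=(V,E)$ be a rooted directed tree with root $\mathsf{root}$. For $u,b\in V$, consider a weight system $\lambda_u=\{\lambda_{uv}\}$ of complex numbers and let $W_{f,g}$ be the rank one extension of the weighted join operator $W^{(b)}_{\lambda_u}$ on $\mathscr T$, where $f\in\ell^2(V)\ominus\mathscr H$ is non-zero and $g:U\to\mathbb C$ is given ($U$, $\mathscr H=\ell^2(U)$, $A_u$, $W_{f,g}$ and compatibility condition I are defined in the context). Suppose that $W_{f,g}$ satisfies the compatibility condition I. Then the following statements are equivalent: (i) $W_{f,g}$ is normal. (ii) $W_{f,g}$ is diagonal with respect to the orthonormal basis $\{e_v\}_{v\in V}$. (iii) $g=0$ and either $b=u$ or $\lambda_{uv}=0$ for every $v\in A_u\setminus\{u\}$.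
   Context: Trees. A directed tree $\mathscr T=(V,E)$ is a directed graph (no loops, $V$ and $E$ nonempty) which has no circuits, is connected (ignoring orientation), and in which every non-root vertex $v$ has exactly one parent $\mathsf{par}(v)$; it is rooted if there is a unique vertex $\mathsf{root}$ without parent. Throughout $\mathrm{card}(V)=\aleph_0$. $\mathsf{Des}(u)$ is the set of descendants of $u$, including $u$; $\mathsf{Asc}(u)=\{\mathsf{par}^{\langle n\rangle}(u):n\ge1\}$; for $v\in\mathsf{Des}(u)$, $[u,v]$ is the set of vertices of the directed path from $u$ to $v$ and $\mathsf{Des}_v(u)=\mathsf{Des}(u)\setminus[u,v]$. Rank one extension. Let $u,b\in V$ and $\{\lambda_{uv}\}_{v\in V}\subseteq\mathbb C$. Put $U=V\setminus\{u\}$ if $b=u$; $U=\mathsf{Asc}(u)\cup\mathsf{Des}_b(u)$ if $b\in\mathsf{Des}(u)\setminus\{u\}$; $U=\mathsf{Des}(u)\setminus\{u\}$ if $b\notin\mathsf{Des}(u)$. Put $A_u=[u,b]$ if $b\in\mathsf{Des}(u)$ and $A_u=\mathsf{Asc}(u)\cup\{b,u\}$ otherwise. $\mathscr H=\mathscr H^{(b)}_u=\ell^2(U)\subseteq\ell^2(V)$. $D=D^{(b)}_{\lambda_u}$ is the maximally defined diagonal operator in $\mathscr H$ with $De_v=\lambda_{uv}e_v$ ($v\in U$), and $N=N^{(b)}_{\lambda_u}=e_u\otimes e_{\lambda_u,A_u}$ on $\ell^2(V)\ominus\mathscr H$, with $e_{\lambda_u,A_u}=\sum_{v\in A_u}\overline{\lambda_{uv}}e_v$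 and $(x\otimes y)h=\langle h,y\rangle x$. (The weighted join operator is $W^{(b)}_{\lambda_u}=D\oplus N$.) The operator $f\oslash g$ has domain $\{h\in\mathscr H:\sum_{v\in U}h(v)\overline{g(v)}\text{ is convergent}\}$ and $(f\oslash g)h=\big(\sum_{v\in U}h(v)\overline{g(v)}\big)f$. $W_{f,g}$ is the operator in $\ell^2(V)$ with domain $\{(h,k):h\in\mathscr D(D)\cap\mathscr D(f\oslash g),\ k\in\ell^2(V)\ominus\mathscr H\}$ and $W_{f,g}=\begin{bmatrix}D&0\\ f\oslash g&N\end{bmatrix}$. Compatibility condition I: there is $\mu_0\in\mathbb C$ with $\inf_{v\in U}|\mu_0-\lambda_{uv}|>0$ and $\sum_{v\in U}\frac{|g(v)|^2}{|\lambda_{uv}-\mu_0|^2}<\infty$. A densely defined operator $T$ is normal if $\mathscr D(T)=\mathscr D(T^* )$ and $\|T^*x\|=\|Tx\|$ for all $x\in\mathscr D(T)$. *)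

theory Defs
  imports "HOL-Analysis.Analysis" "Graph_Theory.Graph_Theory"
begin

section \<open>Rooted directed trees\<close>

text \<open>
  \<open>forest\<close> is the absence of directed cycles, and \<open>Digraph_Component.connected\<close> is
  connectedness of the underlying symmetric graph (it includes non-emptiness of the vertex set).
  Vertex sets are countably infinite throughout.
\<close>

locale directed_tree = pair_loopfree_digraph T for T :: "'a pair_pre_digraph" +
  assumes arcs_nonempty: "parcs T \<noteq> {}"
    and no_circuits: "forest T"
    and connected_tree: "Digraph_Component.connected T"
    and unique_parent:
      "\<lbrakk>v \<in> pverts T; \<exists>w. (w, v) \<in> parcs T\<rbrakk> \<Longrightarrow> \<exists>!w. (w, v) \<in> parcs T"
    and countable_verts: "countable (pverts T)"
    and infinite_verts: "infinite (pverts T)"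

locale rooted_directed_tree = directed_tree +
  assumes ex1_root: "\<exists>!r. r \<in> pverts T \<and> (\<nexists>w. (w, r) \<in> parcs T)"

definition par :: "'a pair_pre_digraph \<Rightarrow> 'a \<Rightarrow> 'a option" where
  "par T v = (if \<exists>w. (w, v) \<in> parcs T then Some (THE w. (w, v) \<in> parcs T) else None)"

text \<open>The iterated parent; it is \<open>None\<close> once the root has been passed.\<close>

primrec par_iter :: "'a pair_pre_digraph \<Rightarrow> nat \<Rightarrow> 'a \<Rightarrow> 'a option" where
  "par_iter T 0 v = Some v"
| "par_iter T (Suc n) v = Option.bind (par_iter T n v) (par T)"

definition Des :: "'a pair_pre_digraph \<Rightarrow> 'a \<Rightarrow> 'a set" where
  "Des T u = {v. u \<rightarrow>\<^sup>*\<^bsub>T\<^esub> v}"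

definition Asc :: "'a pair_pre_digraph \<Rightarrow> 'a \<Rightarrow> 'a set" where
  "Asc T u = {w. \<exists>n\<ge>1. par_iter T n u = Some w}"

text \<open>The set \<open>[u,v]\<close> of vertices of the directed path from \<open>u\<close> to \<open>v\<close>.\<close>

definition path_verts :: "'a pair_pre_digraph \<Rightarrow> 'a \<Rightarrow> 'a \<Rightarrow> 'a set" where
  "path_verts T u v = {w. \<exists>p. pre_digraph.apath T u p v \<and> w \<in> set (pawalk_verts u p)}"

definition Des_minus :: "'a pair_pre_digraph \<Rightarrow> 'a \<Rightarrow> 'a \<Rightarrow> 'a set" where
  "Des_minus T v u = Des T u - path_verts T u v"


section \<open>The Hilbert spaces $\ell^2(X)$\<close>

text \<open>
  Vectors of $\ell^2(X)$ are extended by zero outside \<open>X\<close>, so that $\ell^2(U)$ is literally a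
  subspace of $\ell^2(V)$ for \<open>U \<subseteq> V\<close>, and the inner product and norm need no index set.
\<close>

definition l2 :: "'a set \<Rightarrow> ('a \<Rightarrow> complex) set" where
  "l2 X = {h. (\<forall>v. v \<notin> X \<longrightarrow> h v = 0) \<and> (\<lambda>v. (cmod (h v))\<^sup>2) summable_on X}"

definition l2_inner :: "('a \<Rightarrow> complex) \<Rightarrow> ('a \<Rightarrow> complex) \<Rightarrow> complex" where
  "l2_inner h k = (\<Sum>\<^sub>\<infinity>v. h v * cnj (k v))"

definition l2_norm :: "('a \<Rightarrow> complex) \<Rightarrow> real" where
  "l2_norm h = sqrt (\<Sum>\<^sub>\<infinity>v. (cmod (h v))\<^sup>2)"

definition l2_compl :: "'a set \<Rightarrow> 'a set \<Rightarrow> ('a \<Rightarrow> complex) set" where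
  "l2_compl V U = {k \<in> l2 V. \<forall>h \<in> l2 U. l2_inner h k = 0}"

definition basis_vec :: "'a \<Rightarrow> 'a \<Rightarrow> complex" where
  "basis_vec v = (\<lambda>w. if w = v then 1 else 0)"


section \<open>Unbounded operators\<close>

text \<open>
  A (not necessarily everywhere defined) operator is represented by its graph; its domain is
  \<open>Domain A\<close>. Equality of graphs is equality of domains and of values.
\<close>

type_synonym 'a l2_op = "(('a \<Rightarrow> complex) \<times> ('a \<Rightarrow> complex)) set"

definition densely_defined :: "'a set \<Rightarrow> 'a l2_op \<Rightarrow> bool" where
  "densely_defined V A \<longleftrightarrow>
     Domain A \<subseteq> l2 V \<and>
     (\<forall>x \<in> l2 V. \<forall>\<epsilon>>0. \<exists>y \<in> Domain A. l2_norm (\<lambda>v. x v - y v) < \<epsilon>)"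

definition adjoint_op :: "'a set \<Rightarrow> 'a l2_op \<Rightarrow> 'a l2_op" where
  "adjoint_op V A =
     {(y, z). y \<in> l2 V \<and> z \<in> l2 V \<and> (\<forall>(x, w) \<in> A. l2_inner w y = l2_inner x z)}"

definition normal_op :: "'a set \<Rightarrow> 'a l2_op \<Rightarrow> bool" where
  "normal_op V A \<longleftrightarrow>
     densely_defined V A \<and>
     Domain A = Domain (adjoint_op V A) \<and>
     (\<forall>x y z. (x, y) \<in> A \<longrightarrow> (x, z) \<in> adjoint_op V A \<longrightarrow> l2_norm z = l2_norm y)"

text \<open>The maximally defined diagonal operator in $\ell^2(X)$ with $e_v \mapsto d_v e_v$.\<close>

definition diag_op :: "'a set \<Rightarrow> ('a \<Rightarrow> complex) \<Rightarrow> 'a l2_op" where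
  "diag_op X d = {(h, \<lambda>v. d v * h v) | h. h \<in> l2 X \<and> (\<lambda>v. d v * h v) \<in> l2 X}"

definition diagonal_op :: "'a set \<Rightarrow> 'a l2_op \<Rightarrow> bool" where
  "diagonal_op X A \<longleftrightarrow> (\<exists>d. A = diag_op X d)"


section \<open>Rank one extensions of weighted join operators\<close>

text \<open>
  Below, \<open>l v\<close> stands for the weight $\lambda_{uv}$ (the vertex \<open>u\<close> is fixed), and only the
  values of \<open>g\<close> on \<open>join_U T u b\<close> are relevant.
\<close>

definition join_U :: "'a pair_pre_digraph \<Rightarrow> 'a \<Rightarrow> 'a \<Rightarrow> 'a set" where
  "join_U T u b =
     (if b = u then pverts T - {u}
      else if b \<in> Des T u then Asc T u \<union> Des_minus T b u
      else Des T u - {u})"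

definition join_A :: "'a pair_pre_digraph \<Rightarrow> 'a \<Rightarrow> 'a \<Rightarrow> 'a set" where
  "join_A T u b = (if b \<in> Des T u then path_verts T u b else Asc T u \<union> {b, u})"

text \<open>$e_{\lambda_u,A} = \sum_{v\in A} \overline{\lambda_{uv}} e_v$, written coordinatewise.\<close>

definition e_weights :: "('a \<Rightarrow> complex) \<Rightarrow> 'a set \<Rightarrow> 'a \<Rightarrow> complex" where
  "e_weights l A = (\<lambda>v. if v \<in> A then cnj (l v) else 0)"

text \<open>The bounded operator $x \otimes y$ on the subspace \<open>K\<close>.\<close>

definition rank_one :: "('a \<Rightarrow> complex) set \<Rightarrow> ('a \<Rightarrow> complex) \<Rightarrow> ('a \<Rightarrow> complex) \<Rightarrow> 'a l2_op" where
  "rank_one K x y = {(h, \<lambda>v. l2_inner h y * x v) | h. h \<in> K}"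

text \<open>The operator $f \oslash g$; here \<open>g\<close> need not be square-summable.\<close>

definition oslash :: "'a set \<Rightarrow> ('a \<Rightarrow> complex) \<Rightarrow> ('a \<Rightarrow> complex) \<Rightarrow> 'a l2_op" where
  "oslash U f g =
     {(h, \<lambda>w. (\<Sum>\<^sub>\<infinity>v\<in>U. h v * cnj (g v)) * f w) | h.
        h \<in> l2 U \<and> (\<lambda>v. h v * cnj (g v)) summable_on U}"

definition join_D :: "'a pair_pre_digraph \<Rightarrow> 'a \<Rightarrow> 'a \<Rightarrow> ('a \<Rightarrow> complex) \<Rightarrow> 'a l2_op" where
  "join_D T u b l = diag_op (join_U T u b) l"

definition join_N :: "'a pair_pre_digraph \<Rightarrow> 'a \<Rightarrow> 'a \<Rightarrow> ('a \<Rightarrow> complex) \<Rightarrow> 'a l2_op" where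
  "join_N T u b l =
     rank_one (l2_compl (pverts T) (join_U T u b)) (basis_vec u) (e_weights l (join_A T u b))"

text \<open>
  The pair $(h,k)$ in the orthogonal sum of $\ell^2(U)$ and its complement is identified with
  $h + k$; the three summands of the value come from the entries of the block matrix.
\<close>

definition rank_one_ext ::
  "'a pair_pre_digraph \<Rightarrow> 'a \<Rightarrow> 'a \<Rightarrow> ('a \<Rightarrow> complex) \<Rightarrow> ('a \<Rightarrow> complex) \<Rightarrow> ('a \<Rightarrow> complex) \<Rightarrow> 'a l2_op"
where
  "rank_one_ext T u b l f g =
     {(\<lambda>v. h v + k v, \<lambda>v. p v + q v + r v) | h k p q r.
        (h, p) \<in> join_D T u b l \<and> (h, q) \<in> oslash (join_U T u b) f g \<and> (k, r) \<in> join_N T u b l}"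

text \<open>The infimum is taken in the extended reals, since \<open>U\<close> may be empty.\<close>

definition compatibility_I :: "'a set \<Rightarrow> ('a \<Rightarrow> complex) \<Rightarrow> ('a \<Rightarrow> complex) \<Rightarrow> bool" where
  "compatibility_I U l g \<longleftrightarrow>
     (\<exists>\<mu>. (INF v\<in>U. ereal (cmod (\<mu> - l v))) > 0 \<and>
          (\<lambda>v. (cmod (g v))\<^sup>2 / (cmod (l v - \<mu>))\<^sup>2) summable_on U)"

end

theory Submission
  imports Defs
begin

text \<open>
  In the basis of the vertices the operator is an infinite matrix, and normality of an operator
  whose domain contains every basis vector forces the column and the row of this matrix at each
  index \<open>v\<close> to have the same norm: they are the images of \<open>e\<^sub>v\<close> under the operator and, up to
  conjugation, under its adjoint (lemma \<open>normal_op_row_column_norm\<close>).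

  At \<open>v \<in> U\<close> the row consists of the diagonal entry \<open>l v\<close>, since \<open>f\<close> and \<open>e\<^sub>u\<close> live outside \<open>U\<close>,
  while the column also contains \<open>cnj (g v) f\<close>, which is orthogonal to \<open>e\<^sub>v\<close>. Equality of the norms
  and \<open>f \<noteq> 0\<close> give \<open>g v = 0\<close>. Once \<open>g\<close> vanishes, the row at a vertex \<open>v \<notin> U\<close> other than \<open>u\<close> is
  zero, whereas the column is \<open>l v e\<^sub>u\<close> for \<open>v \<in> A\<close>; so \<open>l\<close> vanishes on \<open>A - {u}\<close>.
  If conversely all these entries vanish, the matrix is diagonal and the operator is the maximal
  diagonal operator with this diagonal (lemma \<open>block_op_eq_diag_op\<close>). Finally, a maximal diagonal
  operator is normal, because its adjoint is the maximal diagonal operator with conjugate entries.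

  The tree enters through \<open>u \<in> A\<close> and the disjointness of \<open>U\<close> and \<open>A\<close>. The latter is the absence
  of directed cycles: an ascendant of \<open>u\<close> is never a descendant of \<open>u\<close>.
\<close>

section \<open>Square-summable families\<close>

lemma l2_altdef: "h \<in> l2 X \<longleftrightarrow> (\<forall>v. v \<notin> X \<longrightarrow> h v = 0) \<and> (\<lambda>v. (cmod (h v))\<^sup>2) summable_on UNIV"
proof -
  have "(\<lambda>v. (cmod (h v))\<^sup>2) summable_on X \<longleftrightarrow> (\<lambda>v. (cmod (h v))\<^sup>2) summable_on UNIV"
    if "\<forall>v. v \<notin> X \<longrightarrow> h v = 0"
    by (rule summable_on_cong_neutral) (use that in auto)
  then show ?thesis
    unfolding l2_def by blast
qed

lemma l2_mono: "h \<in> l2 X \<Longrightarrow> X \<subseteq> Y \<Longrightarrow> h \<in> l2 Y"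
  unfolding l2_altdef by blast

lemma l2_outside: "h \<in> l2 X \<Longrightarrow> v \<notin> X \<Longrightarrow> h v = 0"
  by (simp add: l2_def)

lemma l2_restrict:
  assumes "x \<in> l2 V"
  shows "(\<lambda>v. if v \<in> X then x v else 0) \<in> l2 (X \<inter> V)"
proof -
  have "(\<lambda>v. (cmod (x v))\<^sup>2) summable_on (X \<inter> V)"
    using assms by (auto simp: l2_def intro: summable_on_subset_banach)
  then show ?thesis
    using assms
    by (auto simp: l2_def intro: summable_on_cong[THEN iffD1, rotated])
qed

lemma l2_add_disjoint:
  assumes "x \<in> l2 X" "y \<in> l2 Y" "X \<inter> Y = {}"
  shows "(\<lambda>v. x v + y v) \<in> l2 (X \<union> Y)"
proof -
  have "(\<lambda>v. (cmod (x v + y v))\<^sup>2) summable_on X \<longleftrightarrow> (\<lambda>v. (cmod (x v))\<^sup>2) summable_on X"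
    using assms by (intro summable_on_cong) (auto simp: l2_def)
  moreover have "(\<lambda>v. (cmod (x v + y v))\<^sup>2) summable_on Y \<longleftrightarrow> (\<lambda>v. (cmod (y v))\<^sup>2) summable_on Y"
    using assms by (intro summable_on_cong) (auto simp: l2_def)
  ultimately have "(\<lambda>v. (cmod (x v + y v))\<^sup>2) summable_on (X \<union> Y)"
    using assms by (intro summable_on_Un_disjoint) (auto simp: l2_def)
  then show ?thesis
    using assms by (auto simp: l2_def)
qed

lemma l2_scale:
  assumes "x \<in> l2 X"
  shows "(\<lambda>v. c * x v) \<in> l2 X"
  using assms by (auto simp: l2_def norm_mult power_mult_distrib intro: summable_on_cmult_right)

lemma finite_support_in_l2:
  assumes "finite F" "F \<subseteq> X" "\<And>v. v \<notin> F \<Longrightarrow> h v = 0"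
  shows "h \<in> l2 X"
proof -
  have "(\<lambda>v. (cmod (h v))\<^sup>2) summable_on F \<longleftrightarrow> (\<lambda>v. (cmod (h v))\<^sup>2) summable_on X"
    by (rule summable_on_cong_neutral) (use assms in auto)
  then show ?thesis
    using assms by (auto simp: l2_def)
qed

lemma basis_vec_in_l2: "v \<in> X \<Longrightarrow> basis_vec v \<in> l2 X"
  by (rule finite_support_in_l2[of "{v}"]) (auto simp: basis_vec_def)

lemma infsum_single_support:
  fixes F :: "'a \<Rightarrow> 'b::{comm_monoid_add, t2_space}"
  assumes "\<And>w. w \<noteq> v \<Longrightarrow> F w = 0"
  shows "(\<Sum>\<^sub>\<infinity>w. F w) = F v"
proof -
  have "infsum F UNIV = infsum F {v}"
    by (rule infsum_cong_neutral) (use assms in auto)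
  then show ?thesis by simp
qed

lemma l2_inner_basis_right: "l2_inner h (basis_vec v) = h v"
  unfolding l2_inner_def by (subst infsum_single_support[of v]) (auto simp: basis_vec_def)

lemma l2_inner_basis_left: "l2_inner (basis_vec v) k = cnj (k v)"
  unfolding l2_inner_def by (subst infsum_single_support[of v]) (auto simp: basis_vec_def)

lemma l2_norm_single_support:
  assumes "\<And>w. w \<noteq> v \<Longrightarrow> h w = 0"
  shows "l2_norm h = cmod (h v)"
  unfolding l2_norm_def by (subst infsum_single_support[of v]) (use assms in auto)

lemma l2_norm_sq: "(l2_norm h)\<^sup>2 = (\<Sum>\<^sub>\<infinity>v. (cmod (h v))\<^sup>2)"
  unfolding l2_norm_def by (simp add: infsum_nonneg)

lemma l2_norm_pos:
  assumes "f \<in> l2 X" "f \<noteq> (\<lambda>_. 0)"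
  shows "(l2_norm f)\<^sup>2 > 0"
proof -
  obtain v where v: "f v \<noteq> 0"
    using assms by blast
  have "(l2_norm f)\<^sup>2 \<noteq> 0"
    unfolding l2_norm_sq
    using nonneg_infsum_le_0D[of "\<lambda>v. (cmod (f v))\<^sup>2" UNIV v] assms v
    by (auto simp: l2_altdef)
  then show ?thesis by simp
qed

lemma l2_norm_sq_basis_plus:
  assumes "f \<in> l2 X" "w \<notin> X"
  shows "(l2_norm (\<lambda>v. a * basis_vec w v + c * f v))\<^sup>2 = (cmod a)\<^sup>2 + (cmod c)\<^sup>2 * (l2_norm f)\<^sup>2"
proof -
  have f0: "f w = 0"
    using assms by (simp add: l2_outside)
  have "(cmod (a * basis_vec w v + c * f v))\<^sup>2
      = (cmod a)\<^sup>2 * (cmod (basis_vec w v))\<^sup>2 + (cmod c)\<^sup>2 * (cmod (f v))\<^sup>2" for v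
    using f0 by (auto simp: basis_vec_def norm_mult power_mult_distrib)
  moreover have "basis_vec w \<in> l2 UNIV" "f \<in> l2 UNIV"
    using basis_vec_in_l2[of w UNIV] l2_mono[OF assms(1)] by auto
  moreover have "l2_norm (basis_vec w) = 1"
    by (subst l2_norm_single_support[of w]) (auto simp: basis_vec_def)
  ultimately show ?thesis
    unfolding l2_norm_sq
    by (simp add: infsum_add summable_on_cmult_right infsum_cmult_right l2_def flip: l2_norm_sq)
qed

lemma l2_compl_eq:
  assumes "U \<subseteq> V"
  shows "l2_compl V U = l2 (V - U)"
proof (intro equalityI subsetI)
  fix k assume k: "k \<in> l2_compl V U"
  have "cnj (k v) = 0" if "v \<in> U" for v
    using k that basis_vec_in_l2[OF that] l2_inner_basis_left[of v k] by (auto simp: l2_compl_def)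
  then show "k \<in> l2 (V - U)"
    using k by (auto simp: l2_compl_def l2_altdef)
next
  fix k assume k: "k \<in> l2 (V - U)"
  have "l2_inner h k = 0" if "h \<in> l2 U" for h
  proof -
    have "h v * cnj (k v) = 0" for v
      using k that by (cases "v \<in> U") (auto simp: l2_def)
    then show ?thesis
      unfolding l2_inner_def by (rule infsum_0)
  qed
  then show "k \<in> l2_compl V U"
    using l2_mono[OF k, of V] by (auto simp: l2_compl_def)
qed

section \<open>Maximal diagonal operators are normal\<close>

text \<open>
  Truncating a vector to a large finite set of coordinates changes its norm little, since the
  tails of a convergent sum become small.
\<close>

lemma densely_definedI:
  assumes dom: "Domain A \<subseteq> l2 V"
    and fin: "\<And>F h. finite F \<Longrightarrow> F \<subseteq> V \<Longrightarrow> (\<And>v. v \<notin> F \<Longrightarrow> h v = 0) \<Longrightarrow> h \<in> Domain A"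
  shows "densely_defined V A"
  unfolding densely_defined_def
proof (intro conjI ballI allI impI dom)
  fix x and \<epsilon> :: real assume x: "x \<in> l2 V" and \<epsilon>: "\<epsilon> > 0"
  let ?S = "\<lambda>v. (cmod (x v))\<^sup>2"
  have S: "?S summable_on V"
    using x by (simp add: l2_def)
  obtain F where F: "finite F" "F \<subseteq> V" "dist (sum ?S F) (infsum ?S V) \<le> \<epsilon>\<^sup>2 / 2"
    using infsum_finite_approximation[OF S, of "\<epsilon>\<^sup>2 / 2"] \<epsilon> by auto
  define y where "y = (\<lambda>v. if v \<in> F then x v else 0)"
  have "infsum (\<lambda>v. (cmod (x v - y v))\<^sup>2) UNIV = infsum ?S (V - F)"
    by (rule infsum_cong_neutral) (use x in \<open>auto simp: y_def l2_def\<close>)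
  also have "\<dots> = infsum ?S V - sum ?S F"
    using F S infsum_Diff[of ?S V F] by simp
  also have "\<dots> \<le> \<epsilon>\<^sup>2 / 2"
    using F by (simp add: dist_real_def abs_if split: if_splits)
  also have "\<dots> < \<epsilon>\<^sup>2"
    using \<epsilon> by simp
  finally have "l2_norm (\<lambda>v. x v - y v) < \<epsilon>"
    unfolding l2_norm_def using \<epsilon> by (simp add: real_less_lsqrt)
  moreover have "y \<in> Domain A"
    by (rule fin[OF F(1,2)]) (simp add: y_def)
  ultimately show "\<exists>y\<in>Domain A. l2_norm (\<lambda>v. x v - y v) < \<epsilon>"
    by blast
qed

lemma mem_diag_op: "(x, y) \<in> diag_op V d \<longleftrightarrow> x \<in> l2 V \<and> y = (\<lambda>v. d v * x v) \<and> y \<in> l2 V"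
  by (auto simp: diag_op_def)

lemma finite_support_in_Domain_diag_op:
  assumes "finite F" "F \<subseteq> V" "\<And>v. v \<notin> F \<Longrightarrow> h v = 0"
  shows "(h, \<lambda>v. d v * h v) \<in> diag_op V d"
  unfolding mem_diag_op using assms finite_support_in_l2[OF assms(1,2)] by auto

text \<open>
  Testing against the basis vectors determines every value of the adjoint, so the adjoint cannot
  exceed the maximal diagonal operator with conjugate entries.
\<close>

lemma adjoint_diag_op: "adjoint_op V (diag_op V d) = diag_op V (\<lambda>v. cnj (d v))"
proof (intro equalityI subrelI)
  fix y z assume yz: "(y, z) \<in> adjoint_op V (diag_op V d)"
  then have l2: "y \<in> l2 V" "z \<in> l2 V"
    by (auto simp: adjoint_op_def)
  have "z v = cnj (d v) * y v" for v
  proof (cases "v \<in> V")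
    case True
    have "(basis_vec v, \<lambda>w. d w * basis_vec v w) \<in> diag_op V d"
      using True by (intro finite_support_in_Domain_diag_op[of "{v}"]) (auto simp: basis_vec_def)
    then have "l2_inner (\<lambda>w. d w * basis_vec v w) y = l2_inner (basis_vec v) z"
      using yz by (auto simp: adjoint_op_def)
    moreover have "l2_inner (\<lambda>w. d w * basis_vec v w) y = d v * cnj (y v)"
      unfolding l2_inner_def by (subst infsum_single_support[of v]) (auto simp: basis_vec_def)
    ultimately have "cnj (z v) = d v * cnj (y v)"
      by (simp add: l2_inner_basis_left)
    then show ?thesis
      by (metis complex_cnj_cnj complex_cnj_mult)
  next
    case False
    then show ?thesis using l2 by (simp add: l2_outside)
  qed
  then have "z = (\<lambda>v. cnj (d v) * y v)" ..
  with l2 show "(y, z) \<in> diag_op V (\<lambda>v. cnj (d v))"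
    by (simp add: mem_diag_op)
next
  fix y z assume "(y, z) \<in> diag_op V (\<lambda>v. cnj (d v))"
  then show "(y, z) \<in> adjoint_op V (diag_op V d)"
    by (auto simp: adjoint_op_def mem_diag_op l2_inner_def mult_ac)
qed

lemma normal_diag_op: "normal_op V (diag_op V d)"
proof -
  have cnj_iff: "(\<lambda>v. cnj (d v) * h v) \<in> l2 V \<longleftrightarrow> (\<lambda>v. d v * h v) \<in> l2 V" for h
    by (simp add: l2_def norm_mult)
  have "Domain (diag_op V d) = Domain (diag_op V (\<lambda>v. cnj (d v)))"
    by (auto simp: Domain_iff mem_diag_op cnj_iff)
  moreover have "densely_defined V (diag_op V d)"
    by (rule densely_definedI)
       (auto simp: mem_diag_op intro!: DomainI[OF finite_support_in_Domain_diag_op])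
  moreover have "l2_norm z = l2_norm y"
    if "(x, y) \<in> diag_op V d" "(x, z) \<in> diag_op V (\<lambda>v. cnj (d v))" for x y z
    using that by (simp add: mem_diag_op l2_norm_def norm_mult)
  ultimately show ?thesis
    unfolding normal_op_def adjoint_diag_op by blast
qed

section \<open>Rows and columns of a normal operator\<close>

text \<open>
  \<open>M w\<close> is the column at \<open>w\<close>, the image of \<open>e\<^sub>w\<close>. By duality the adjoint maps \<open>e\<^sub>v\<close> to the
  conjugate of the row at \<open>v\<close>.
\<close>

lemma normal_op_row_column_norm:
  assumes normal: "normal_op V A"
    and M: "\<And>w. w \<in> V \<Longrightarrow> (basis_vec w, M w) \<in> A"
    and v: "v \<in> V"
  shows "l2_norm (\<lambda>w. if w \<in> V then cnj (M w v) else 0) = l2_norm (M v)"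
proof -
  have "basis_vec v \<in> Domain (adjoint_op V A)"
    using normal M[OF v] unfolding normal_op_def by blast
  then obtain z where z: "(basis_vec v, z) \<in> adjoint_op V A"
    by blast
  have "z w = (if w \<in> V then cnj (M w v) else 0)" for w
  proof (cases "w \<in> V")
    case True
    then have "l2_inner (M w) (basis_vec v) = l2_inner (basis_vec w) z"
      using z M[OF True] by (auto simp: adjoint_op_def)
    then show ?thesis
      using True by (simp add: l2_inner_basis_left l2_inner_basis_right)
  next
    case False
    then show ?thesis using z by (auto simp: adjoint_op_def l2_outside)
  qed
  then have "z = (\<lambda>w. if w \<in> V then cnj (M w v) else 0)" ..
  then show ?thesis
    using normal z M[OF v] unfolding normal_op_def by blast
qed

section \<open>Rank one extensions over an arbitrary splitting of the index set\<close>

text \<open>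
  A rank one extension in terms of its index sets alone, so that it can be studied without
  reference to the tree from which \<open>U\<close> and \<open>A\<close> come.
\<close>

definition block_op ::
  "'a set \<Rightarrow> 'a set \<Rightarrow> 'a set \<Rightarrow> 'a \<Rightarrow> ('a \<Rightarrow> complex) \<Rightarrow> ('a \<Rightarrow> complex) \<Rightarrow> ('a \<Rightarrow> complex) \<Rightarrow> 'a l2_op"
where
  "block_op V U A u l f g =
     {(\<lambda>v. h v + k v,
       \<lambda>v. l v * h v + (\<Sum>\<^sub>\<infinity>v\<in>U. h v * cnj (g v)) * f v
             + l2_inner k (e_weights l A) * basis_vec u v) | h k.
        h \<in> l2 U \<and> (\<lambda>v. l v * h v) \<in> l2 U \<and> (\<lambda>v. h v * cnj (g v)) summable_on U \<and>
        k \<in> l2 (V - U)}"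

lemma block_opI:
  assumes "h \<in> l2 U" "(\<lambda>v. l v * h v) \<in> l2 U" "(\<lambda>v. h v * cnj (g v)) summable_on U"
    and "k \<in> l2 (V - U)"
    and "\<And>v. x v = h v + k v"
    and "\<And>v. y v = l v * h v + (\<Sum>\<^sub>\<infinity>v\<in>U. h v * cnj (g v)) * f v
                 + l2_inner k (e_weights l A) * basis_vec u v"
  shows "(x, y) \<in> block_op V U A u l f g"
proof -
  have "x = (\<lambda>v. h v + k v)"
    and "y = (\<lambda>v. l v * h v + (\<Sum>\<^sub>\<infinity>v\<in>U. h v * cnj (g v)) * f v
                 + l2_inner k (e_weights l A) * basis_vec u v)"
    using assms(5,6) by auto
  then show ?thesis
    using assms(1-4) unfolding block_op_def by blast
qed

lemma rank_one_ext_eq_block_op: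
  assumes "join_U T u b \<subseteq> pverts T"
  shows "rank_one_ext T u b l f g = block_op (pverts T) (join_U T u b) (join_A T u b) u l f g"
proof -
  have D: "(h, p) \<in> join_D T u b l \<longleftrightarrow>
      h \<in> l2 (join_U T u b) \<and> (\<lambda>v. l v * h v) \<in> l2 (join_U T u b) \<and> p = (\<lambda>v. l v * h v)" for h p
    by (auto simp: join_D_def diag_op_def)
  have O: "(h, q) \<in> oslash (join_U T u b) f g \<longleftrightarrow>
      h \<in> l2 (join_U T u b) \<and> (\<lambda>v. h v * cnj (g v)) summable_on join_U T u b \<and>
      q = (\<lambda>w. (\<Sum>\<^sub>\<infinity>v\<in>join_U T u b. h v * cnj (g v)) * f w)" for h q
    by (auto simp: oslash_def)
  have N: "(k, r) \<in> join_N T u b l \<longleftrightarrow>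
      k \<in> l2 (pverts T - join_U T u b) \<and>
      r = (\<lambda>v. l2_inner k (e_weights l (join_A T u b)) * basis_vec u v)" for k r
    by (auto simp: join_N_def rank_one_def l2_compl_eq[OF assms])
  show ?thesis
    unfolding rank_one_ext_def block_op_def D O N by (intro Collect_cong) auto
qed

locale splitting =
  fixes V U A :: "'a set" and u :: 'a
  assumes U_subset: "U \<subseteq> V" and A_subset: "A \<subseteq> V - U" and u_in_A: "u \<in> A"
begin

text \<open>The column of the matrix at the index \<open>w\<close>, that is, the image of \<open>e\<^sub>w\<close>.\<close>

definition column :: "('a \<Rightarrow> complex) \<Rightarrow> ('a \<Rightarrow> complex) \<Rightarrow> ('a \<Rightarrow> complex) \<Rightarrow> 'a \<Rightarrow> 'a \<Rightarrow> complex"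
  where "column l f g w =
    (if w \<in> U then (\<lambda>v. l w * basis_vec w v + cnj (g w) * f v)
     else (\<lambda>v. (if w \<in> A then l w else 0) * basis_vec u v))"

lemma basis_vec_column_in_block_op:
  assumes "w \<in> V"
  shows "(basis_vec w, column l f g w) \<in> block_op V U A u l f g"
proof (cases "w \<in> U")
  case True
  let ?G = "\<lambda>v. basis_vec w v * cnj (g v)"
  have sum: "?G summable_on U" "infsum ?G U = cnj (g w)"
  proof -
    have "?G summable_on U \<longleftrightarrow> ?G summable_on {w}"
      by (rule summable_on_cong_neutral) (use True in \<open>auto simp: basis_vec_def\<close>)
    then show "?G summable_on U" by simp
    have "infsum ?G U = infsum ?G {w}"
      by (rule infsum_cong_neutral) (use True in \<open>auto simp: basis_vec_def\<close>)
    then show "infsum ?G U = cnj (g w)" by (simp add: basis_vec_def)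
  qed
  have lw: "(\<lambda>v. l v * basis_vec w v) \<in> l2 U"
    by (rule finite_support_in_l2[of "{w}"]) (use True in \<open>auto simp: basis_vec_def\<close>)
  have "(\<lambda>_. 0) \<in> l2 (V - U)"
    by (rule finite_support_in_l2[of "{}"]) auto
  moreover have "l2_inner (\<lambda>_. 0) (e_weights l A) = 0"
    by (simp add: l2_inner_def)
  moreover have "column l f g w v = l v * basis_vec w v + cnj (g w) * f v" for v
    using True by (simp add: column_def basis_vec_def)
  ultimately show ?thesis
    using True sum
    by (intro block_opI[where h = "basis_vec w" and k = "\<lambda>_. 0", OF _ lw])
       (simp_all add: basis_vec_in_l2)
next
  case False
  have "(\<lambda>_. 0) \<in> l2 U"
    by (rule finite_support_in_l2[of "{}"]) auto
  then show ?thesis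
    using False assms
    by (intro block_opI[where h = "\<lambda>_. 0" and k = "basis_vec w"])
       (simp_all add: column_def basis_vec_in_l2 l2_inner_basis_left e_weights_def)
qed

text \<open>
  The order matters: the column at a vertex of \<open>A - {u}\<close> can be compared with a zero row only after
  \<open>g\<close> is known to vanish, because that row has the entries \<open>cnj (g w) f v\<close> for \<open>w \<in> U\<close>.
\<close>

lemma normal_imp_entries_zero:
  assumes normal: "normal_op V (block_op V U A u l f g)"
    and f: "f \<in> l2 (V - U)" "f \<noteq> (\<lambda>_. 0)"
  shows "\<forall>v\<in>U. g v = 0" and "\<forall>v\<in>A - {u}. l v = 0"
proof -
  let ?M = "column l f g"
  have u: "u \<in> V" "u \<notin> U"
    using u_in_A A_subset by auto
  have norms: "l2_norm (\<lambda>w. if w \<in> V then cnj (?M w v) else 0) = l2_norm (?M v)" if "v \<in> V" for v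
    using normal_op_row_column_norm[OF normal basis_vec_column_in_block_op that] .
  have g0: "g v = 0" if v: "v \<in> U" for v
  proof -
    have fv: "f v = 0" and vV: "v \<in> V"
      using f v U_subset by (auto simp: l2_outside)
    have "l2_norm (\<lambda>w. if w \<in> V then cnj (?M w v) else 0) = cmod (l v)"
      by (subst l2_norm_single_support[of v])
         (use v vV fv u in \<open>auto simp: column_def basis_vec_def\<close>)
    moreover have "(l2_norm (?M v))\<^sup>2 = (cmod (l v))\<^sup>2 + (cmod (g v))\<^sup>2 * (l2_norm f)\<^sup>2"
      using l2_norm_sq_basis_plus[OF f(1), of v "l v" "cnj (g v)"] v by (simp add: column_def)
    ultimately have "(cmod (g v))\<^sup>2 * (l2_norm f)\<^sup>2 = 0"
      using norms[OF vV] by simp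
    then show ?thesis
      using l2_norm_pos[OF f] by simp
  qed
  then show "\<forall>v\<in>U. g v = 0" by blast
  show "\<forall>v\<in>A - {u}. l v = 0"
  proof
    fix v assume v: "v \<in> A - {u}"
    then have vV: "v \<in> V" "v \<notin> U"
      using A_subset by auto
    have "(\<lambda>w. if w \<in> V then cnj (?M w v) else 0) = (\<lambda>_. 0)"
      using v vV g0 by (auto simp: column_def basis_vec_def fun_eq_iff)
    moreover have "l2_norm (?M v) = cmod (l v)"
      by (subst l2_norm_single_support[of u])
         (use v vV in \<open>auto simp: column_def basis_vec_def\<close>)
    ultimately show "l v = 0"
      using norms[OF vV(1)] by (simp add: l2_norm_def)
  qed
qed

text \<open>
  The coordinates in \<open>V - U\<close> other than \<open>u\<close> are sent to zero, hence the zero entries in the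
  diagonal. The two domains agree because the entry at \<open>u\<close> alone does not affect summability.
\<close>

lemma block_op_eq_diag_op:
  assumes g: "\<forall>v\<in>U. g v = 0" and l: "\<forall>v\<in>A - {u}. l v = 0"
  shows "block_op V U A u l f g = diag_op V (\<lambda>v. if v \<in> U \<or> v = u then l v else 0)"
    (is "_ = diag_op V ?d")
proof -
  have u: "u \<in> V" "u \<notin> U"
    using u_in_A A_subset by auto
  have gsum: "(\<lambda>v. h v * cnj (g v)) summable_on U" "(\<Sum>\<^sub>\<infinity>v\<in>U. h v * cnj (g v)) = 0" for h
    using g by (auto simp: summable_on_0 infsum_0)
  have inner: "l2_inner k (e_weights l A) = k u * l u" for k
    unfolding l2_inner_def
    by (subst infsum_single_support[of u]) (use l u_in_A in \<open>auto simp: e_weights_def\<close>)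
  have image: "l v * h v + (\<Sum>\<^sub>\<infinity>v\<in>U. h v * cnj (g v)) * f v
      + l2_inner k (e_weights l A) * basis_vec u v = ?d v * (h v + k v)"
    if "h \<in> l2 U" "k \<in> l2 (V - U)" for h k v
    using that u by (auto simp: gsum inner l2_outside basis_vec_def)
  have VU: "U \<union> (V - U) = V" "U \<inter> V = U" "(V - U) \<inter> V = V - U"
    using U_subset by auto
  show ?thesis
  proof (intro equalityI subrelI)
    fix x y assume "(x, y) \<in> block_op V U A u l f g"
    then obtain h k where hk: "h \<in> l2 U" "(\<lambda>v. l v * h v) \<in> l2 U" "k \<in> l2 (V - U)"
      and x: "x = (\<lambda>v. h v + k v)" and y: "y = (\<lambda>v. ?d v * (h v + k v))"
      unfolding block_op_def using image by auto
    have "x \<in> l2 V"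
      using l2_add_disjoint[OF hk(1,3)] x VU by auto
    moreover have "(\<lambda>v. l v * h v + k u * l u * basis_vec u v) \<in> l2 (U \<union> (V - U))"
      using u by (intro l2_add_disjoint hk l2_scale basis_vec_in_l2) auto
    moreover have "y = (\<lambda>v. l v * h v + k u * l u * basis_vec u v)"
      using image[OF hk(1,3)] by (simp add: y gsum inner)
    ultimately show "(x, y) \<in> diag_op V ?d"
      unfolding mem_diag_op x y VU by auto
  next
    fix x y assume "(x, y) \<in> diag_op V ?d"
    then have x: "x \<in> l2 V" and y: "y = (\<lambda>v. ?d v * x v)" "y \<in> l2 V"
      by (auto simp: mem_diag_op)
    define h where "h = (\<lambda>v. if v \<in> U then x v else 0)"
    define k where "k = (\<lambda>v. if v \<in> V - U then x v else 0)"
    have h: "h \<in> l2 U" and k: "k \<in> l2 (V - U)"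
      using l2_restrict[OF x, of U] l2_restrict[OF x, of "V - U"] VU by (simp_all add: h_def k_def)
    have "(\<lambda>v. l v * h v) = (\<lambda>v. if v \<in> U then y v else 0)"
      by (auto simp: h_def y)
    then have lh: "(\<lambda>v. l v * h v) \<in> l2 U"
      using l2_restrict[OF y(2), of U] VU by simp
    have xhk: "x v = h v + k v" for v
      using x by (auto simp: h_def k_def l2_outside)
    show "(x, y) \<in> block_op V U A u l f g"
      by (rule block_opI[OF h lh gsum(1) k xhk]) (simp only: image[OF h k] y(1) xhk)
  qed
qed

end

section \<open>The index sets of a weighted join operator\<close>

context directed_tree
begin

lemma par_eq_Some_imp_arc:
  assumes "par T v = Some w"
  shows "w \<rightarrow>\<^bsub>T\<^esub> v"
proof -
  have ex: "\<exists>w. (w, v) \<in> parcs T" and w: "w = (THE w. (w, v) \<in> parcs T)"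
    using assms by (auto simp: par_def split: if_splits)
  then have "\<exists>!w. (w, v) \<in> parcs T"
    using unique_parent[of v] in_arcsD2 by blast
  from theI'[OF this] show ?thesis
    using w by simp
qed

lemma Asc_imp_reachable1:
  assumes "w \<in> Asc T v"
  shows "w \<rightarrow>\<^sup>+\<^bsub>T\<^esub> v"
proof -
  have "par_iter T (Suc n) v = Some w \<Longrightarrow> w \<rightarrow>\<^sup>+\<^bsub>T\<^esub> v" for n w
  proof (induction n arbitrary: w)
    case 0
    then show ?case using par_eq_Some_imp_arc by auto
  next
    case (Suc n)
    then obtain w' where "par_iter T (Suc n) v = Some w'" "par T w' = Some w"
      by (auto simp: Option.bind_eq_Some_conv)
    with Suc.IH show ?case
      using par_eq_Some_imp_arc by (meson trancl_into_trancl2)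
  qed
  moreover obtain n where "par_iter T n v = Some w" "n \<ge> 1"
    using assms by (auto simp: Asc_def)
  ultimately show ?thesis
    by (cases n) auto
qed

lemma reachable1_imp_not_reachable:
  assumes "w \<rightarrow>\<^sup>+\<^bsub>T\<^esub> v"
  shows "\<not> v \<rightarrow>\<^sup>*\<^bsub>T\<^esub> w"
proof
  assume "v \<rightarrow>\<^sup>*\<^bsub>T\<^esub> w"
  with assms have "w \<rightarrow>\<^sup>+\<^bsub>T\<^esub> w"
    using reachable1_reachable_trans by simp
  then obtain p where "awalk w p w" "p \<noteq> []"
    by (auto simp: reachable1_awalk)
  then have "closed_w p"
    by (auto simp: closed_w_def)
  then show False
    using closed_w_imp_cycle no_circuits by (auto simp: forest_def)
qed

lemma Asc_disjoint_Des: "Asc T v \<inter> Des T v = {}"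
  using Asc_imp_reachable1 reachable1_imp_not_reachable by (auto simp: Des_def)

lemma Asc_subset_verts: "Asc T v \<subseteq> pverts T"
  using Asc_imp_reachable1 reachable1_in_verts by fastforce

lemma Des_subset_verts: "Des T v \<subseteq> pverts T"
  using reachable_in_verts by (fastforce simp: Des_def)

lemma path_verts_subset_Des: "path_verts T v w \<subseteq> Des T v"
proof
  fix x assume "x \<in> path_verts T v w"
  then obtain p where "apath v p w" "x \<in> set (awalk_verts v p)"
    by (auto simp: path_verts_def)
  then show "x \<in> Des T v"
    by (auto simp: Des_def apath_def intro: awalk_verts_reachable_from)
qed

lemma source_in_path_verts:
  assumes "w \<in> Des T v"
  shows "v \<in> path_verts T v w"
  using assms hd_in_awalk_verts(2) by (auto simp: Des_def path_verts_def reachable_apath)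

lemma path_verts_self: "path_verts T v v \<subseteq> {v}"
proof
  fix x assume "x \<in> path_verts T v v"
  then obtain p where p: "apath v p v" "x \<in> set (pawalk_verts v p)"
    by (auto simp: path_verts_def)
  then have "p = []"
    using apath_nonempty_ends by blast
  with p show "x \<in> {v}"
    by simp
qed

lemma splitting_join:
  assumes "u \<in> pverts T" "b \<in> pverts T"
  shows "splitting (pverts T) (join_U T u b) (join_A T u b) u"
proof -
  have "u \<in> Des T u"
    using assms by (simp add: Des_def)
  moreover have "u \<notin> Asc T u"
    using Asc_disjoint_Des[of u] calculation by auto
  ultimately show ?thesis
    using assms Asc_disjoint_Des[of u] Asc_subset_verts[of u] Des_subset_verts[of u]
      path_verts_subset_Des[of u b] path_verts_self[of u] source_in_path_verts[of b u]
    by unfold_locales (auto simp: join_U_def join_A_def Des_minus_def)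
qed

lemma join_A_self:
  assumes "u \<in> pverts T"
  shows "join_A T u u - {u} = {}"
  using assms path_verts_self[of u] by (simp add: join_A_def Des_def)

end

section \<open>Normal rank one extensions\<close>

theorem proposition5p4:
  fixes T :: "'a pair_pre_digraph" and u b :: 'a
    and l f g :: "'a \<Rightarrow> complex"
  assumes "rooted_directed_tree T"
    and "u \<in> pverts T" and "b \<in> pverts T"
    and "f \<in> l2_compl (pverts T) (join_U T u b)" and "f \<noteq> (\<lambda>_. 0)"
    and "compatibility_I (join_U T u b) l g"
  shows "(normal_op (pverts T) (rank_one_ext T u b l f g) \<longleftrightarrow>
            diagonal_op (pverts T) (rank_one_ext T u b l f g)) \<and>
         (diagonal_op (pverts T) (rank_one_ext T u b l f g) \<longleftrightarrow>
            (\<forall>v \<in> join_U T u b. g v = 0) \<and>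
            (b = u \<or> (\<forall>v \<in> join_A T u b - {u}. l v = 0)))"
proof -
  interpret rooted_directed_tree T by fact
  let ?V = "pverts T" and ?U = "join_U T u b" and ?A = "join_A T u b"
  let ?W = "rank_one_ext T u b l f g"
  interpret splitting ?V ?U ?A u
    using assms(2,3) by (rule splitting_join)
  have W: "?W = block_op ?V ?U ?A u l f g"
    using U_subset by (rule rank_one_ext_eq_block_op)
  have f: "f \<in> l2 (?V - ?U)"
    using assms(4) l2_compl_eq[OF U_subset] by simp
  have "diagonal_op ?V ?W \<Longrightarrow> normal_op ?V ?W"
    using normal_diag_op by (auto simp: diagonal_op_def)
  moreover have "(\<forall>v\<in>?U. g v = 0) \<and> (\<forall>v\<in>?A - {u}. l v = 0)" if "normal_op ?V ?W"
    using normal_imp_entries_zero[OF that[unfolded W] f assms(5)] by blast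
  moreover have "diagonal_op ?V ?W" if "\<forall>v\<in>?U. g v = 0" "\<forall>v\<in>?A - {u}. l v = 0"
    using block_op_eq_diag_op[OF that] by (auto simp: W diagonal_op_def)
  \<comment> \<open>For \<open>b = u\<close> the set \<open>A\<close> is \<open>{u}\<close>, so the condition on the weights is void.\<close>
  moreover have "b = u \<Longrightarrow> \<forall>v\<in>?A - {u}. l v = 0"
    using join_A_self[OF assms(2)] by blast
  ultimately show ?thesis
    by blast
qed

end
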